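(* Let $l=1$ and consider either (discrete case) $T=[-\pi,\pi]$ with Lebesgue measure and $A(n)$ the set of trigonometric polynomials of degree $\le n$, or (continuous case) $T=\mathbb R$ with Lebesgue measure and $A(n)$ the set of entire functions of exponential type $\le n$; in both cases $\sigma(n)=n$, $n\geq 3$. Let $G(\psi)$ and $G(\nu)$ be two arbitrary Grand Lebesgue spaces over $T$ (no relation between their supports is assumed). Then $$\liminf_{n\to\infty} W_n(G(\psi),G(\nu))=C>0 .$$
   Context: $|f|_p=\left(\int_T|f(x)|^p\,dx\right)^{1/p}$. Grand Lebesgue space: for $1\le a<b\le\infty$ and a continuous positive function $\psi$ on the open interval $(a,b)$ with $\inf_{p\in(a,b)}\psi(p)>0$ and $\sup_{p\in(a,b)}\psi(p)=\infty$, the space $G(\psi)=G(\psi;a,b)$ consists of all measurable $f:T\to\mathbb R$ with finite norm $\|f\|G(\psi)=\sup_{p\in(a,b)}\left[|f|_p/\psi(p)\right]$; its support is $(a,b)$. The two spaces $G(\psi)$, $G(\nu)$ may have different intervals. Entire functions of exponential type $\le n$ on $\mathbb R$: functions $t_n(x)=\int_{-n}^{n}e^{ix\xi}g(\xi)\,d\xi$ with $g\in L_2(\mathbb R)$. Fundamental function of a rearrangement invariant space $(X,\|\cdot\|X)$ over $T$: $\phi(X,\delta)=\sup_{A:\,m(A)\le\delta}\|I(A)\|X$, where $m$ is Lebesgue measure and $I(A)$ is the indicator of $A$. Nikol'skii two-space functional: $$W_n(X,Y)=\sup_{t_n\in A(n),\,t_n\ne0}\left[\frac{\|t_n\|X}{\phi(X,1/\sigma(n))}\Big/\frac{\|t_n\|Y}{\phi(Y,1/\sigma(n))}\right],$$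 the supremum being over those $t_n$ for which the ratio is meaningful. *)

theory Defs
  imports "HOL-Analysis.Analysis"
begin

text \<open>
  Functions on \<open>T\<close> are represented by total functions on the reals of which only the values on
  \<open>T\<close> matter. Norms take values in \<^typ>\<open>ennreal\<close>; the space belonging to a norm consists of the
  measurable functions of finite norm.
\<close>

definition Lp_norm :: "real set \<Rightarrow> real \<Rightarrow> (real \<Rightarrow> real) \<Rightarrow> ennreal" where
  "Lp_norm T p f =
     (let I = (\<integral>\<^sup>+x. ennreal (\<bar>f x\<bar> powr p) \<partial>lebesgue_on T)
      in if I = top then top else ennreal (enn2real I powr (1 / p)))"

definition support_interval :: "real \<Rightarrow> ereal \<Rightarrow> real set" where
  "support_interval a b = {p. a < p \<and> ereal p < b}"

definition grand_weight :: "real \<Rightarrow> ereal \<Rightarrow> (real \<Rightarrow> real) \<Rightarrow> bool" where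
  "grand_weight a b \<psi> \<longleftrightarrow>
     1 \<le> a \<and> ereal a < b \<and>
     continuous_on (support_interval a b) \<psi> \<and>
     (\<forall>p\<in>support_interval a b. 0 < \<psi> p) \<and>
     0 < (INF p\<in>support_interval a b. ereal (\<psi> p)) \<and>
     (SUP p\<in>support_interval a b. ereal (\<psi> p)) = \<infinity>"

definition grand_norm ::
    "real set \<Rightarrow> real \<Rightarrow> ereal \<Rightarrow> (real \<Rightarrow> real) \<Rightarrow> (real \<Rightarrow> real) \<Rightarrow> ennreal" where
  "grand_norm T a b \<psi> f = (SUP p\<in>support_interval a b. Lp_norm T p f / ennreal (\<psi> p))"

definition fin_norm_space :: "real set \<Rightarrow> ((real \<Rightarrow> real) \<Rightarrow> ennreal) \<Rightarrow> (real \<Rightarrow> real) set" where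
  "fin_norm_space T N = {f \<in> borel_measurable (lebesgue_on T). N f < top}"

definition fundamental_function ::
    "real set \<Rightarrow> ((real \<Rightarrow> real) \<Rightarrow> ennreal) \<Rightarrow> real \<Rightarrow> ennreal" where
  "fundamental_function T N \<delta> =
     (SUP A\<in>{A \<in> sets (lebesgue_on T). emeasure (lebesgue_on T) A \<le> ennreal \<delta>}. N (indicator A))"

definition trig_polys :: "nat \<Rightarrow> (real \<Rightarrow> complex) set" where
  "trig_polys n = {t. \<exists>c :: int \<Rightarrow> complex.
     \<forall>x. t x = (\<Sum>k = - int n..int n. c k * cis (of_int k * x))}"

definition exp_type_functions :: "nat \<Rightarrow> (real \<Rightarrow> complex) set" where
  "exp_type_functions n = {t. \<exists>g :: real \<Rightarrow> complex.
     g \<in> borel_measurable lebesgue \<and> integrable lebesgue (\<lambda>\<xi>. (cmod (g \<xi>))\<^sup>2) \<and>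
     (\<forall>x. t x = (LINT \<xi>:{- real n..real n}|lebesgue. cis (x * \<xi>) * g \<xi>))}"

text \<open>
  The spaces consist of real functions, so the supremum runs over the real-valued members of
  \<open>A n\<close>. The quotient is taken to be meaningful when \<open>t\<close> lies in both spaces.
\<close>

definition nikolskii ::
    "real set \<Rightarrow> (nat \<Rightarrow> (real \<Rightarrow> complex) set) \<Rightarrow> (nat \<Rightarrow> real) \<Rightarrow>
     ((real \<Rightarrow> real) \<Rightarrow> ennreal) \<Rightarrow> ((real \<Rightarrow> real) \<Rightarrow> ennreal) \<Rightarrow> nat \<Rightarrow> ennreal" where
  "nikolskii T A \<sigma> X Y n =
     (SUP t\<in>{t. (\<lambda>x. complex_of_real (t x)) \<in> A n \<and> (\<exists>x\<in>T. t x \<noteq> 0) \<and>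
                t \<in> fin_norm_space T X \<and> t \<in> fin_norm_space T Y}.
        (X t / fundamental_function T X (1 / \<sigma> n)) /
        (Y t / fundamental_function T Y (1 / \<sigma> n)))"

end

theory Submission imports Defs begin

text \<open>
  If a kernel \<open>f\<close> with \<open>0 \<le> f \<le> 1\<close> is at least \<open>c\<close> on \<open>[0, 1/n]\<close> and \<open>f x \<le> K / (n x)\<^sup>2\<close>, then
  \<open>\<integral>f\<^sup>p \<le> \<integral>f = O(1/n)\<close> for \<open>p \<ge> 1\<close>, so \<open>|f|\<^sub>p\<close> is comparable with \<open>(1/n)\<^bsup>1/p\<^esup>\<close> uniformly in \<open>p\<close>.
  Hence the norm of \<open>f\<close> in every Grand Lebesgue space is comparable with the fundamental
  function at \<open>1/n\<close>, with constants that do not depend on the space, and the quotient in the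
  functional is bounded below. The Fejer kernel (discrete case) and the function
  \<open>(sin(nx/2) / (nx/2))\<^sup>2\<close> (continuous case) are such kernels.
\<close>

section \<open>Integral of the Cauchy majorant and two-sided bounds for L_p norms\<close>

text \<open>This profile later dominates the kernels: it has an arctangent as explicit
  antiderivative, and its total mass is of order \<open>1 / r\<close>.\<close>

lemma nn_integral_scaled_cauchy_le:
  fixes r K :: real
  assumes r: "0 < r" and K: "0 \<le> K"
  shows "(\<integral>\<^sup>+x. ennreal (K / (1 + (r * x)\<^sup>2)) \<partial>lborel) \<le> ennreal (K * pi / r)"
proof -
  let ?f = "\<lambda>x. K / (1 + (r * x)\<^sup>2)"
  let ?g = "\<lambda>x. ennreal (?f x) * indicator {0..} x"
  have half: "(\<integral>\<^sup>+x. ?g x \<partial>lborel) = ennreal (K / r * (pi / 2) - K / r * arctan (r * 0))"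
  proof (rule nn_integral_FTC_atLeast)
    show "((\<lambda>x. K / r * arctan (r * x)) has_real_derivative ?f x) (at x)" for x
    proof -
      have "((\<lambda>x. K / r * arctan (r * x)) has_real_derivative
              K / r * (inverse (1 + (r * x)\<^sup>2) * r)) (at x)"
        by (intro DERIV_cmult DERIV_chain'[OF _ DERIV_arctan] DERIV_cmult_Id)
      then show ?thesis
        using r by (simp add: field_simps)
    qed
    have "filterlim (\<lambda>x. r * x) at_top at_top"
      using r by (intro filterlim_tendsto_pos_mult_at_top[OF tendsto_const] filterlim_ident)
    from filterlim_compose[OF tendsto_arctan_at_top this]
    show "((\<lambda>x. K / r * arctan (r * x)) \<longlongrightarrow> K / r * (pi / 2)) at_top"
      by (intro tendsto_intros)
  qed (use K in auto)
  \<comment> \<open>Evenness doubles the half-line integral. Both halves contain the point 0, which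
    gives an inequality at this stage; \<open>0 + -1 * x\<close> is the shape expected by the affine
    substitution below.\<close>
  have "(\<integral>\<^sup>+x. ennreal (?f x) \<partial>lborel) \<le> (\<integral>\<^sup>+x. ?g x + ?g (0 + -1 * x) \<partial>lborel)"
    by (intro nn_integral_mono) (auto simp: indicator_def)
  also have "\<dots> = (\<integral>\<^sup>+x. ?g x \<partial>lborel) + (\<integral>\<^sup>+x. ?g (0 + -1 * x) \<partial>lborel)"
    by (intro nn_integral_add) auto
  also have "(\<integral>\<^sup>+x. ?g (0 + -1 * x) \<partial>lborel) = (\<integral>\<^sup>+x. ?g x \<partial>lborel)"
    by (subst (2) nn_integral_real_affine[where c = "-1" and t = 0]) auto
  also have "(\<integral>\<^sup>+x. ?g x \<partial>lborel) + (\<integral>\<^sup>+x. ?g x \<partial>lborel) = ennreal (K * pi / r)"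
    unfolding half using r K by (subst ennreal_plus[symmetric]) (auto simp: field_simps)
  finally show ?thesis .
qed

lemma Lp_norm_le:
  assumes "0 < p" "0 \<le> B" "(\<integral>\<^sup>+x. ennreal (\<bar>f x\<bar> powr p) \<partial>lebesgue_on T) \<le> ennreal B"
  shows "Lp_norm T p f \<le> ennreal (B powr (1 / p))"
proof -
  let ?I = "\<integral>\<^sup>+x. ennreal (\<bar>f x\<bar> powr p) \<partial>lebesgue_on T"
  have "enn2real ?I \<le> B"
    using assms by (simp add: enn2real_leI)
  \<comment> \<open>An infinite integral falls into the other branch of \<open>Lp_norm\<close>, so
    finiteness is settled before real powers are compared.\<close>
  moreover have "?I \<noteq> top"
    using assms(3) by (auto simp: top_unique)
  ultimately show ?thesis
    using assms by (auto simp: Lp_norm_def Let_def intro!: ennreal_leI powr_mono2)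
qed

lemma Lp_norm_ge:
  assumes "0 < p" "0 \<le> B" "ennreal B \<le> (\<integral>\<^sup>+x. ennreal (\<bar>f x\<bar> powr p) \<partial>lebesgue_on T)"
  shows "ennreal (B powr (1 / p)) \<le> Lp_norm T p f"
proof -
  let ?I = "\<integral>\<^sup>+x. ennreal (\<bar>f x\<bar> powr p) \<partial>lebesgue_on T"
  show ?thesis
  proof (cases "?I = top")
    case False
    then have "B \<le> enn2real ?I"
      using assms by (metis enn2real_ennreal enn2real_mono top.not_eq_extremum)
    then show ?thesis
      using assms False by (auto simp: Lp_norm_def Let_def intro!: ennreal_leI powr_mono2)
  qed (auto simp: Lp_norm_def)
qed

lemma nn_integral_indicator_powr:
  assumes "A \<in> sets M" "0 < p"
  shows "(\<integral>\<^sup>+x. ennreal (indicator A x powr p) \<partial>M) = emeasure M A"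
proof -
  have "(\<integral>\<^sup>+x. ennreal (indicator A x powr p) \<partial>M) = (\<integral>\<^sup>+x. indicator A x \<partial>M)"
    using assms by (intro nn_integral_cong) (auto simp: indicator_def)
  then show ?thesis
    using assms by simp
qed

section \<open>Grand Lebesgue norms and their fundamental functions\<close>

text \<open>The closed form of the fundamental function at \<delta>: the indicator of a set of
  measure \<delta> has L_p norm \<delta>^(1/p). It depends on the weight only, not on
  \<open>T\<close>.\<close>

definition grand_scale :: "real \<Rightarrow> ereal \<Rightarrow> (real \<Rightarrow> real) \<Rightarrow> real \<Rightarrow> ennreal" where
  "grand_scale a b \<psi> \<delta> = (SUP p\<in>support_interval a b. ennreal (\<delta> powr (1 / p)) / ennreal (\<psi> p))"

text \<open>Since \<open>c\<close> does not depend on \<open>p\<close>, it can be pulled out of the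
  supremum over the support; the same holds for the lower bound that follows.\<close>

lemma grand_norm_le_scale:
  assumes "0 \<le> c" "\<And>p. p \<in> support_interval a b \<Longrightarrow> Lp_norm T p f \<le> ennreal (c * \<delta> powr (1 / p))"
  shows "grand_norm T a b \<psi> f \<le> ennreal c * grand_scale a b \<psi> \<delta>"
  unfolding grand_norm_def grand_scale_def SUP_mult_left_ennreal
  using assms by (intro SUP_mono) (metis divide_right_mono_ennreal ennreal_mult' ennreal_times_divide)

lemma grand_norm_ge_scale:
  assumes "0 \<le> c" "\<And>p. p \<in> support_interval a b \<Longrightarrow> ennreal (c * \<delta> powr (1 / p)) \<le> Lp_norm T p f"
  shows "ennreal c * grand_scale a b \<psi> \<delta> \<le> grand_norm T a b \<psi> f"
  unfolding grand_norm_def grand_scale_def SUP_mult_left_ennreal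
  using assms by (intro SUP_mono) (metis divide_right_mono_ennreal ennreal_mult' ennreal_times_divide)

lemma support_interval_ge_1:
  assumes "grand_weight a b \<psi>" "p \<in> support_interval a b"
  shows "1 \<le> p"
  using assms by (auto simp: grand_weight_def support_interval_def)

lemma grand_scale_pos:
  assumes "grand_weight a b \<psi>" "0 < \<delta>"
  shows "0 < grand_scale a b \<psi> \<delta>"
proof -
  \<comment> \<open>The support is nonempty; a supremum over the empty set would be 0 in
    \<open>ennreal\<close>.\<close>
  obtain p where p: "ereal a < ereal p" "ereal p < b"
    using ereal_dense2[of "ereal a" b] assms(1) by (auto simp: grand_weight_def)
  then have p': "p \<in> support_interval a b"
    by (simp add: support_interval_def)
  then have "0 < ennreal (\<delta> powr (1 / p)) / ennreal (\<psi> p)"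
    using assms by (auto simp: grand_weight_def divide_ennreal)
  also have "\<dots> \<le> grand_scale a b \<psi> \<delta>"
    unfolding grand_scale_def using p' by (rule SUP_upper)
  finally show ?thesis .
qed

text \<open>Each numerator is at most 1 because \<delta> \<le> 1, and the denominators stay away
  from 0 because the infimum of the weight is positive.\<close>

lemma grand_scale_finite:
  assumes w: "grand_weight a b \<psi>" and \<delta>: "0 < \<delta>" "\<delta> \<le> 1"
  shows "grand_scale a b \<psi> \<delta> < top"
proof -
  obtain d where d: "0 < ereal d" "ereal d < (INF p\<in>support_interval a b. ereal (\<psi> p))"
    using ereal_dense2[of 0 "INF p\<in>support_interval a b. ereal (\<psi> p)"] w
    by (auto simp: grand_weight_def)
  have "grand_scale a b \<psi> \<delta> \<le> ennreal (1 / d)"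
    unfolding grand_scale_def
  proof (rule SUP_least)
    fix p assume p: "p \<in> support_interval a b"
    then have "d \<le> \<psi> p"
      using d(2) INF_lower[OF p, of "\<lambda>p. ereal (\<psi> p)"] by (meson ereal_less_eq(3) less_imp_le order_trans)
    moreover have "\<delta> powr (1 / p) \<le> 1"
      using \<delta> support_interval_ge_1[OF w p] by (intro powr_le1) auto
    ultimately show "ennreal (\<delta> powr (1 / p)) / ennreal (\<psi> p) \<le> ennreal (1 / d)"
      using d(1) by (subst divide_ennreal) (auto intro!: ennreal_leI frac_le)
  qed
  then show ?thesis
    by (simp add: order.strict_trans1)
qed

text \<open>Every admissible set has L_p norm at most \<delta>^(1/p) for all \<open>p\<close> at
  once, and the interval \<open>{0..\<delta>}\<close> attains all these bounds
  simultaneously.\<close>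

lemma fundamental_function_grand_norm:
  assumes w: "grand_weight a b \<psi>" and \<delta>: "0 < \<delta>"
    and T: "T \<in> sets lebesgue" "{0..\<delta>} \<subseteq> T"
  shows "fundamental_function T (grand_norm T a b \<psi>) \<delta> = grand_scale a b \<psi> \<delta>"
proof (rule antisym)
  show "fundamental_function T (grand_norm T a b \<psi>) \<delta> \<le> grand_scale a b \<psi> \<delta>"
    unfolding fundamental_function_def
  proof (rule SUP_least)
    fix A assume A: "A \<in> {A \<in> sets (lebesgue_on T). emeasure (lebesgue_on T) A \<le> ennreal \<delta>}"
    have "grand_norm T a b \<psi> (indicator A) \<le> ennreal 1 * grand_scale a b \<psi> \<delta>"
    proof (rule grand_norm_le_scale)
      fix p assume "p \<in> support_interval a b"
      then have "1 \<le> p" using w by (rule support_interval_ge_1[rotated])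
      then show "Lp_norm T p (indicator A) \<le> ennreal (1 * \<delta> powr (1 / p))"
        using A \<delta> by (simp, intro Lp_norm_le) (auto simp: nn_integral_indicator_powr)
    qed simp
    then show "grand_norm T a b \<psi> (indicator A) \<le> grand_scale a b \<psi> \<delta>" by simp
  qed
  have A: "{0..\<delta>} \<in> sets (lebesgue_on T)"
    using T by (simp add: sets_restrict_space_iff)
  have em: "emeasure (lebesgue_on T) {0..\<delta>} = ennreal \<delta>"
    using T \<delta> by (simp add: emeasure_restrict_space)
  have "ennreal 1 * grand_scale a b \<psi> \<delta> \<le> grand_norm T a b \<psi> (indicator {0..\<delta>})"
  proof (rule grand_norm_ge_scale)
    fix p assume "p \<in> support_interval a b"
    then have "1 \<le> p" using w by (rule support_interval_ge_1[rotated])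
    then show "ennreal (1 * \<delta> powr (1 / p)) \<le> Lp_norm T p (indicator {0..\<delta>})"
      using A \<delta> em by (simp, intro Lp_norm_ge) (auto simp: nn_integral_indicator_powr)
  qed simp
  also have "\<dots> \<le> fundamental_function T (grand_norm T a b \<psi>) \<delta>"
    unfolding fundamental_function_def using A em by (intro SUP_upper) auto
  finally show "grand_scale a b \<psi> \<delta> \<le> fundamental_function T (grand_norm T a b \<psi>) \<delta>" by simp
qed

section \<open>Concentrated kernels and the Nikol'skii functional\<close>

lemma concentrated_kernel_grand_norm:
  fixes r K c :: real
  assumes w: "grand_weight a b \<psi>" and r: "0 < r" and T: "T \<in> sets lebesgue" "{0..1 / r} \<subseteq> T"
    and c: "0 < c" "\<And>x. 0 \<le> x \<Longrightarrow> x \<le> 1 / r \<Longrightarrow> c \<le> f x"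
    and K: "0 \<le> K" "\<And>x. x \<in> T \<Longrightarrow> 0 \<le> f x" "\<And>x. x \<in> T \<Longrightarrow> f x \<le> 1"
       "\<And>x. x \<in> T \<Longrightarrow> f x * (r * x)\<^sup>2 \<le> K"
  shows "ennreal c * grand_scale a b \<psi> (1 / r) \<le> grand_norm T a b \<psi> f"
    and "grand_norm T a b \<psi> f \<le> ennreal (pi * (1 + K)) * grand_scale a b \<psi> (1 / r)"
proof -
  have A: "{0..1 / r} \<in> sets (lebesgue_on T)"
    using T by (simp add: sets_restrict_space_iff)
  have em: "emeasure (lebesgue_on T) {0..1 / r} = ennreal (1 / r)"
    using T r by (simp add: emeasure_restrict_space)
  show "ennreal c * grand_scale a b \<psi> (1 / r) \<le> grand_norm T a b \<psi> f"
  proof (rule grand_norm_ge_scale)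
    fix p assume "p \<in> support_interval a b"
    then have p: "1 \<le> p" using w by (rule support_interval_ge_1[rotated])
    \<comment> \<open>Only the part over \<open>{0..1 / r}\<close> is kept; the p-th root then
      returns exactly the factor \<open>c\<close>.\<close>
    have "ennreal (c powr p * (1 / r)) = (\<integral>\<^sup>+x. ennreal (c powr p) * indicator {0..1 / r} x \<partial>lebesgue_on T)"
      using A em r c by (simp add: nn_integral_cmult_indicator ennreal_mult'[symmetric])
    also have "\<dots> \<le> (\<integral>\<^sup>+x. ennreal (\<bar>f x\<bar> powr p) \<partial>lebesgue_on T)"
    proof (rule nn_integral_mono)
      fix x
      show "ennreal (c powr p) * indicator {0..1 / r} x \<le> ennreal (\<bar>f x\<bar> powr p)"
      proof (cases "x \<in> {0..1 / r}")
        case True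
        then have "c \<le> \<bar>f x\<bar>" using c(2)[of x] by auto
        then show ?thesis using True c p by (auto intro!: ennreal_leI powr_mono2)
      qed auto
    qed
    finally have "ennreal ((c powr p * (1 / r)) powr (1 / p)) \<le> Lp_norm T p f"
      using p r by (intro Lp_norm_ge) auto
    moreover have "(c powr p * (1 / r)) powr (1 / p) = c * (1 / r) powr (1 / p)"
      using p r c by (simp add: powr_mult powr_powr powr_divide)
    ultimately show "ennreal (c * (1 / r) powr (1 / p)) \<le> Lp_norm T p f" by simp
  qed (use c in simp)
  show "grand_norm T a b \<psi> f \<le> ennreal (pi * (1 + K)) * grand_scale a b \<psi> (1 / r)"
  proof (rule grand_norm_le_scale)
    fix p assume "p \<in> support_interval a b"
    then have p: "1 \<le> p" using w by (rule support_interval_ge_1[rotated])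
    let ?B = "(1 + K) * pi / r"
    \<comment> \<open>Values in [0, 1] only decrease when raised to a power p \<ge> 1. Adding the
      bounds \<open>f x \<le> 1\<close> and \<open>f x * (r * x)\<^sup>2 \<le> K\<close> yields the
      Cauchy majorant.\<close>
    have pw: "\<bar>f x\<bar> powr p \<le> (1 + K) / (1 + (r * x)\<^sup>2)" if "x \<in> T" for x
    proof -
      have "\<bar>f x\<bar> powr p \<le> \<bar>f x\<bar> powr 1"
        using K(2,3)[OF that] p by (intro powr_mono') auto
      also have "\<dots> = f x" using K(2)[OF that] by simp
      also have "f x * (1 + (r * x)\<^sup>2) \<le> 1 + K"
        using K(3,4)[OF that] by (simp add: algebra_simps)
      then have "f x \<le> (1 + K) / (1 + (r * x)\<^sup>2)"
        by (subst pos_le_divide_eq) (auto simp: add_pos_nonneg)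
      finally show ?thesis .
    qed
    have "(\<integral>\<^sup>+x. ennreal (\<bar>f x\<bar> powr p) \<partial>lebesgue_on T)
        \<le> (\<integral>\<^sup>+x. ennreal ((1 + K) / (1 + (r * x)\<^sup>2)) \<partial>lebesgue_on T)"
      using pw by (intro nn_integral_mono ennreal_leI) auto
    also have "\<dots> = (\<integral>\<^sup>+x. ennreal ((1 + K) / (1 + (r * x)\<^sup>2)) * indicator T x \<partial>lebesgue)"
      using T by (subst nn_integral_restrict_space) auto
    also have "\<dots> \<le> (\<integral>\<^sup>+x. ennreal ((1 + K) / (1 + (r * x)\<^sup>2)) \<partial>lebesgue)"
      by (intro nn_integral_mono) (auto simp: indicator_def)
    also have "\<dots> \<le> ennreal ?B"
      unfolding nn_integral_completion using r K(1) by (intro nn_integral_scaled_cauchy_le) auto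
    finally have "Lp_norm T p f \<le> ennreal (?B powr (1 / p))"
      using p r K(1) by (intro Lp_norm_le) auto
    also have "?B powr (1 / p) = (pi * (1 + K)) powr (1 / p) * (1 / r) powr (1 / p)"
      using r K(1) by (simp add: powr_mult powr_divide mult.commute)
    \<comment> \<open>The base is at least 1, so raising the exponent from 1/p to 1 enlarges it and
      removes the dependence on \<open>p\<close>.\<close>
    also have "\<dots> \<le> (pi * (1 + K)) powr 1 * (1 / r) powr (1 / p)"
    proof (intro mult_right_mono powr_mono)
      have "1 * 1 \<le> pi * (1 + K)"
        using pi_gt3 K(1) by (intro mult_mono) auto
      then show "1 \<le> pi * (1 + K)" by simp
    qed (use p in auto)
    finally show "Lp_norm T p f \<le> ennreal (pi * (1 + K) * (1 / r) powr (1 / p))"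
      using K(1) by (simp add: ennreal_leI)
  qed (use K in simp)
qed

lemma inverse_antimono_ennreal: "x \<le> y \<Longrightarrow> inverse y \<le> inverse (x :: ennreal)"
  including ennreal.lifting by transfer (rule ereal_inverse_antimono)

text \<open>The kernel serves as test function. Each of its norms is compared with the fundamental
  function of its own space, so the two supports never interact.\<close>

lemma nikolskii_ge_of_concentrated_kernel:
  fixes K c :: real
  assumes w: "grand_weight a b \<psi>" "grand_weight a' b' \<nu>"
    and n: "1 \<le> n" and T: "T \<in> sets lebesgue" "{0..1 / real n} \<subseteq> T"
    and c: "0 < c" "\<And>x. 0 \<le> x \<Longrightarrow> x \<le> 1 / real n \<Longrightarrow> c \<le> f x"
    and K: "0 \<le> K" "\<And>x. x \<in> T \<Longrightarrow> 0 \<le> f x" "\<And>x. x \<in> T \<Longrightarrow> f x \<le> 1"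
       "\<And>x. x \<in> T \<Longrightarrow> f x * (real n * x)\<^sup>2 \<le> K"
    and f: "(\<lambda>x. complex_of_real (f x)) \<in> A n" "f \<in> borel_measurable borel"
  shows "ennreal (c / (pi * (1 + K)))
    \<le> nikolskii T A real (grand_norm T a b \<psi>) (grand_norm T a' b' \<nu>) n"
proof -
  let ?X = "grand_norm T a b \<psi>" and ?Y = "grand_norm T a' b' \<nu>"
  let ?x = "grand_scale a b \<psi> (1 / real n)" and ?y = "grand_scale a' b' \<nu> (1 / real n)"
  let ?C = "pi * (1 + K)"
  have n': "0 < real n" "0 < 1 / real n" "1 / real n \<le> 1" using n by auto
  have C: "0 < ?C" using K(1) by (intro mult_pos_pos) auto
  \<comment> \<open>Division in \<open>ennreal\<close> cancels only a factor that is neither 0 nor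
    \<open>top\<close>.\<close>
  have x: "0 < ?x" "?x < top" and y: "0 < ?y" "?y < top"
    using w n' by (auto intro: grand_scale_pos grand_scale_finite)
  note kX = concentrated_kernel_grand_norm[OF w(1) n'(1) T c K]
  note kY = concentrated_kernel_grand_norm[OF w(2) n'(1) T c K]
  have "?X f < top" "?Y f < top"
    using kX(2) kY(2) x y by (auto simp: ennreal_mult_less_top order.strict_trans1)
  moreover have "f \<in> borel_measurable (lebesgue_on T)"
    using f(2) by (intro measurable_restrict_space1 measurable_completion) simp
  moreover have "0 \<in> T" "f 0 \<noteq> 0"
    using T(2) c(1) c(2)[of 0] n' by auto
  ultimately have mem: "f \<in> {t. (\<lambda>x. complex_of_real (t x)) \<in> A n \<and> (\<exists>x\<in>T. t x \<noteq> 0) \<and>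
                t \<in> fin_norm_space T ?X \<and> t \<in> fin_norm_space T ?Y}"
    using f(1) by (auto simp: fin_norm_space_def)
  have cancel: "u * z / z = u" if "0 < z" "z < top" for u z :: ennreal
    using that ennreal_mult_divide_eq[of z u] by (simp add: mult.commute)
  have "ennreal (c / ?C) = ennreal c / ennreal ?C"
    using C c(1) by (simp add: divide_ennreal)
  also have "\<dots> = (ennreal c * ?x / ?x) / (ennreal ?C * ?y / ?y)"
    using x y by (simp add: cancel)
  \<comment> \<open>The numerator is bounded below by the \<open>c\<close> estimate for the first
    space, the denominator above by the \<open>?C\<close> estimate for the second.\<close>
  also have "\<dots> \<le> (?X f / ?x) / (?Y f / ?y)"
    unfolding divide_ennreal_def using kX(1) kY(2)
    by (intro mult_mono inverse_antimono_ennreal) (auto simp: mult.commute)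
  also have "\<dots> \<le> nikolskii T A real ?X ?Y n"
    unfolding nikolskii_def
      fundamental_function_grand_norm[OF w(1) n'(2) T] fundamental_function_grand_norm[OF w(2) n'(2) T]
    using mem by (rule SUP_upper)
  finally show ?thesis .
qed

section \<open>Lower bounds for the sine near 0\<close>

lemma sin_ge_half:
  fixes y :: real
  assumes "0 \<le> y" "y \<le> pi / 2"
  shows "y / 2 \<le> sin y"
proof -
  have "\<bar>sin y - (\<Sum>m<3. sin_coeff m * y ^ m)\<bar> \<le> inverse (fact 3) * \<bar>y\<bar> ^ 3"
    by (rule Maclaurin_sin_bound)
  then have "\<bar>sin y - y\<bar> \<le> y ^ 3 / 6"
    using assms by (simp add: sin_coeff_def eval_nat_numeral fact_numeral divide_simps)
  then have "y - y ^ 3 / 6 \<le> sin y"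
    by linarith
  \<comment> \<open>8/5 is a rational above pi/2 whose square is below 3, so the cubic Taylor term
    is at most y/2.\<close>
  moreover have "y ^ 2 \<le> (8 / 5) ^ 2"
    using assms pi_approx by (intro power_mono) auto
  then have "y * y ^ 2 \<le> y * 3"
    using assms by (intro mult_left_mono) (auto simp: power2_eq_square)
  ultimately show ?thesis
    by (simp add: power3_eq_cube power2_eq_square)
qed

lemma sin_square_ge_quarter:
  fixes y :: real
  assumes "\<bar>y\<bar> \<le> pi / 2"
  shows "y\<^sup>2 / 4 \<le> (sin y)\<^sup>2"
proof -
  have "(\<bar>y\<bar> / 2)\<^sup>2 \<le> (sin \<bar>y\<bar>)\<^sup>2"
    using assms by (intro power_mono sin_ge_half) auto
  moreover have "(sin \<bar>y\<bar>)\<^sup>2 = (sin y)\<^sup>2"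
    by (cases "y \<ge> 0") auto
  ultimately show ?thesis
    by (simp add: power_divide)
qed

text \<open>The left side arises twice: as the squared modulus of \<open>1 - cis y\<close> for the
  Fejer kernel, and in the numerator of the triangle transform.\<close>

lemma one_minus_cos_half:
  fixes y :: real
  shows "2 - 2 * cos y = 4 * (sin (y / 2))\<^sup>2"
  using cos_double_sin[of "y / 2"] by simp

section \<open>The Fejer kernel for the discrete case\<close>

text \<open>The classical Fejer kernel divided by its peak \<open>n + 1\<close>, so that its value
  at 0 is 1. The squared modulus avoids the quotient of sines, which is 0/0 at multiples of 2
  pi.\<close>

definition fejer_kernel :: "nat \<Rightarrow> real \<Rightarrow> real" where
  "fejer_kernel n x = (cmod (\<Sum>k\<le>n. cis (real k * x)) / real (n + 1))\<^sup>2"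

lemma fejer_kernel_in_trig_polys: "(\<lambda>x. complex_of_real (fejer_kernel n x)) \<in> trig_polys n"
proof -
  let ?S = "{..n} \<times> {..n}" and ?d = "\<lambda>(j, k). int j - int k"
  \<comment> \<open>Expanding the squared modulus gives a double sum over frequencies
    \<open>j - k\<close>. The coefficient of frequency \<open>m\<close> counts the pairs with that
    difference, and all differences lie between -n and n.\<close>
  define c where "c m = of_nat (card {q \<in> ?S. ?d q = m}) / (of_nat (n + 1) :: complex)\<^sup>2" for m :: int
  have "complex_of_real (fejer_kernel n x) = (\<Sum>m = - int n..int n. c m * cis (of_int m * x))" for x
  proof -
    let ?D = "\<Sum>k\<le>n. cis (real k * x)"
    have "(\<Sum>m = - int n..int n. c m * cis (of_int m * x)) * (of_nat (n + 1))\<^sup>2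
        = (\<Sum>m = - int n..int n. of_nat (card {q \<in> ?S. ?d q = m}) * cis (of_int m * x))"
      unfolding sum_distrib_right c_def
      by (intro sum.cong refl) (simp del: of_nat_add of_nat_Suc)
    also have "\<dots> = (\<Sum>m = - int n..int n. \<Sum>q\<in>{q \<in> ?S. ?d q = m}. cis (of_int (?d q) * x))"
      by (intro sum.cong) auto
    also have "\<dots> = (\<Sum>q\<in>?S. cis (of_int (?d q) * x))"
      by (rule sum.group) auto
    also have "\<dots> = (\<Sum>j\<le>n. \<Sum>k\<le>n. cis (real j * x) * cnj (cis (real k * x)))"
      by (subst sum.cartesian_product) (auto intro!: sum.cong simp: cis_cnj cis_mult algebra_simps)
    also have "\<dots> = ?D * cnj ?D"
      by (simp add: sum_product)
    also have "\<dots> = complex_of_real ((cmod ?D)\<^sup>2)"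
      by (simp only: complex_norm_square)
    also have "\<dots> = complex_of_real (fejer_kernel n x) * (of_nat (n + 1))\<^sup>2"
      by (simp add: fejer_kernel_def power_divide del: of_nat_add of_nat_Suc)
    finally show ?thesis
      by (simp del: of_nat_add of_nat_Suc)
  qed
  then show ?thesis
    unfolding trig_polys_def by blast
qed

lemma fejer_kernel_nonneg: "0 \<le> fejer_kernel n x"
  by (simp add: fejer_kernel_def)

lemma fejer_kernel_le_1: "fejer_kernel n x \<le> 1"
proof -
  have "cmod (\<Sum>k\<le>n. cis (real k * x)) \<le> (\<Sum>k\<le>n. cmod (cis (real k * x)))"
    by (rule norm_sum)
  then show ?thesis
    unfolding fejer_kernel_def by (intro power_le_one) auto
qed

text \<open>All angles \<open>real k * x\<close> are at most 1 < pi/3, so every cosine is at least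
  1/2 and no cancellation occurs in the real part of the sum.\<close>

lemma fejer_kernel_ge_quarter:
  assumes "1 \<le> n" "0 \<le> x" "x \<le> 1 / real n"
  shows "1 / 4 \<le> fejer_kernel n x"
proof -
  have "1 / 2 \<le> cos (real k * x)" if "k \<le> n" for k
  proof -
    have "real k * x \<le> real n * (1 / real n)"
      using that assms by (intro mult_mono) auto
    then have "real k * x \<le> pi / 3"
      using assms pi_gt3 by simp
    then have "cos (pi / 3) \<le> cos (real k * x)"
      using assms pi_gt3 by (intro cos_monotone_0_pi_le) auto
    then show ?thesis by (simp add: cos_60)
  qed
  then have "(\<Sum>k\<le>n. 1 / 2) \<le> (\<Sum>k\<le>n. cos (real k * x))"
    by (intro sum_mono) auto
  also have "\<dots> = Re (\<Sum>k\<le>n. cis (real k * x))" by simp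
  also have "\<dots> \<le> cmod (\<Sum>k\<le>n. cis (real k * x))" by (rule complex_Re_le_cmod)
  finally have "(1 / 2)\<^sup>2 \<le> fejer_kernel n x"
    unfolding fejer_kernel_def by (intro power_mono) (auto simp: field_simps)
  then show ?thesis by (simp add: power2_eq_square)
qed

text \<open>Summing the geometric series bounds the product of \<open>cmod (1 - cis x)\<close> and
  \<open>cmod ?D\<close> by 2, while the square of the first factor is at least x^2/4 for |x| \<le>
  pi; 16 is 4 times 4.\<close>

lemma fejer_kernel_decay:
  assumes "\<bar>x\<bar> \<le> pi"
  shows "fejer_kernel n x * (real n * x)\<^sup>2 \<le> 16"
proof -
  let ?D = "\<Sum>k\<le>n. cis (real k * x)"
  have "(1 - cis x) * ?D = 1 - cis (real (n + 1) * x)"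
    using sum_gp_basic[of "cis x" n] by (simp add: Complex.DeMoivre cis_mult algebra_simps)
  then have "cmod (1 - cis x) * cmod ?D \<le> 2"
    using norm_triangle_ineq4[of 1 "cis (real (n + 1) * x)"] by (simp add: norm_mult[symmetric])
  then have "(cmod (1 - cis x) * cmod ?D)\<^sup>2 \<le> 2\<^sup>2"
    by (intro power_mono) auto
  moreover have "(cmod (1 - cis x))\<^sup>2 = 2 - 2 * cos x"
    unfolding cmod_power2 using sin_cos_squared_add[of x]
    by (simp add: power2_eq_square algebra_simps)
  moreover have "x\<^sup>2 / 4 \<le> 2 - 2 * cos x"
    using sin_square_ge_quarter[of "x / 2"] assms
    by (simp add: one_minus_cos_half power_divide)
  then have "x\<^sup>2 / 4 * (cmod ?D)\<^sup>2 \<le> (2 - 2 * cos x) * (cmod ?D)\<^sup>2"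
    by (intro mult_right_mono) auto
  ultimately have *: "(cmod ?D)\<^sup>2 * x\<^sup>2 \<le> 16"
    by (simp add: power_mult_distrib mult.commute)
  \<comment> \<open>Passing from \<open>n\<close> to \<open>n + 1\<close> lets the factor cancel the
    normalisation of the kernel.\<close>
  have "fejer_kernel n x * (real n * x)\<^sup>2 \<le> fejer_kernel n x * (real (n + 1) * x)\<^sup>2"
    unfolding power_mult_distrib
    by (intro mult_left_mono mult_right_mono power_mono fejer_kernel_nonneg) auto
  also have "\<dots> = (cmod ?D)\<^sup>2 * x\<^sup>2"
    by (simp add: fejer_kernel_def power_divide power_mult_distrib del: of_nat_add of_nat_Suc)
  finally show ?thesis using * by simp
qed

section \<open>The squared sinc and its Fourier representation for the continuous case\<close>

text \<open>The value 1 at 0 is the continuous extension, and agrees with the integral of the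
  normalised triangle at frequency 0.\<close>

definition sinc_square :: "real \<Rightarrow> real" where
  "sinc_square y = (if y = 0 then 1 else (sin y / y)\<^sup>2)"

lemma sinc_square_nonneg: "0 \<le> sinc_square y"
  by (simp add: sinc_square_def)

lemma sinc_square_le_1: "sinc_square y \<le> 1"
proof -
  have "\<bar>sin y / y\<bar> \<le> 1"
    using abs_sin_x_le_abs_x[of y] by (simp add: divide_le_eq_1)
  then show ?thesis
    by (simp add: sinc_square_def abs_square_le_1)
qed

lemma sinc_square_decay: "sinc_square y * y\<^sup>2 \<le> 1"
  using power_mono[OF abs_sin_le_one, of y 2]
  by (simp add: sinc_square_def power_divide)

lemma sinc_square_ge_quarter: "\<bar>y\<bar> \<le> pi / 2 \<Longrightarrow> 1 / 4 \<le> sinc_square y"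
  using sin_square_ge_quarter[of y]
  by (simp add: sinc_square_def power_divide field_simps)

text \<open>
  The function \<open>(sin(rx/2) / (rx/2))\<^sup>2\<close> is the transform of the triangle \<open>(r - |\<xi>|) / r\<^sup>2\<close>; the
  half-interval integrals at \<open>x\<close> and \<open>-x\<close> add up to it, and their imaginary terms cancel.
\<close>

lemma triangle_half_transform:
  fixes x :: real
  assumes "0 \<le> r"
  shows "((\<lambda>\<xi>. cis (x * \<xi>) * complex_of_real (r - \<xi>)) has_integral
    (if x = 0 then complex_of_real (r\<^sup>2 / 2)
     else (1 - cis (r * x)) / (complex_of_real x)\<^sup>2 + \<i> * complex_of_real (r / x))) {0..r}"
proof (cases "x = 0")
  case True
  have "((\<lambda>\<xi>. complex_of_real (r - \<xi>)) has_integral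
    complex_of_real (r * r - r\<^sup>2 / 2) - complex_of_real (r * 0 - 0\<^sup>2 / 2)) {0..r}"
  proof (rule fundamental_theorem_of_calculus)
    fix \<xi> :: real
    have "((\<lambda>\<xi>. r * \<xi> - \<xi>\<^sup>2 / 2) has_real_derivative r - \<xi>) (at \<xi> within {0..r})"
      by (auto intro!: derivative_eq_intros)
    then show "((\<lambda>\<xi>. complex_of_real (r * \<xi> - \<xi>\<^sup>2 / 2)) has_vector_derivative
        complex_of_real (r - \<xi>)) (at \<xi> within {0..r})"
      by (intro has_vector_derivative_of_real)
         (simp add: has_real_derivative_iff_has_vector_derivative)
  qed (use assms in simp)
  then show ?thesis using True by (simp add: power2_eq_square)
next
  case False
  let ?E = "\<lambda>\<xi>. cis (x * \<xi>)" and ?z = "\<i> * complex_of_real x"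
  \<comment> \<open>Antiderivative from one integration by parts, valid since \<open>?z\<close> is
    nonzero; it is checked below as a function of a complex variable and then restricted to the real
    line.\<close>
  let ?F = "\<lambda>\<xi>. complex_of_real (r - \<xi>) * ?E \<xi> / ?z + ?E \<xi> / ?z\<^sup>2"
  have "((\<lambda>\<xi>. ?E \<xi> * complex_of_real (r - \<xi>)) has_integral ?F r - ?F 0) {0..r}"
  proof (rule fundamental_theorem_of_calculus)
    fix \<xi> :: real
    have z: "?z \<noteq> 0" using False by simp
    have "((\<lambda>w. (of_real r - w) * exp (?z * w) / ?z + exp (?z * w) / ?z\<^sup>2) has_field_derivative
        exp (?z * \<xi>) * (of_real r - \<xi>)) (at (complex_of_real \<xi>))"
      by (rule derivative_eq_intros refl z power_not_zero)+
         (use False in \<open>simp add: field_simps power2_eq_square\<close>)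
    then show "(?F has_vector_derivative ?E \<xi> * complex_of_real (r - \<xi>)) (at \<xi> within {0..r})"
      by (auto dest!: has_vector_derivative_real_field simp: cis_conv_exp mult.assoc)
  qed (use assms in auto)
  moreover have "?F r - ?F 0 = (1 - cis (r * x)) / (complex_of_real x)\<^sup>2 + \<i> * complex_of_real (r / x)"
    using False by (simp add: field_simps power2_eq_square)
  ultimately show ?thesis using False by simp
qed

lemma triangle_transform:
  fixes x :: real
  assumes "0 < r"
  shows "((\<lambda>\<xi>. cis (x * \<xi>) * complex_of_real ((r - \<bar>\<xi>\<bar>) / r\<^sup>2)) has_integral
    complex_of_real (sinc_square (r * x / 2))) {-r..r}"
proof -
  let ?f = "\<lambda>x \<xi>. cis (x * \<xi>) * complex_of_real (r - \<bar>\<xi>\<bar>)"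
  let ?I = "\<lambda>x. if x = 0 then complex_of_real (r\<^sup>2 / 2)
     else (1 - cis (r * x)) / (complex_of_real x)\<^sup>2 + \<i> * complex_of_real (r / x)"
  have pos: "(?f x has_integral ?I x) {0..r}" for x
    using triangle_half_transform[of r x] assms by (rule_tac has_integral_eq) auto
  \<comment> \<open>\<open>?f\<close> is unchanged when both arguments change sign, so reflecting
    the half transform at \<open>-x\<close> gives the integral at \<open>x\<close> over the left
    half.\<close>
  have "((\<lambda>\<xi>. ?f (-x) (-\<xi>)) has_integral ?I (-x)) {-r..-0}"
    using pos[of "-x"] by (subst has_integral_reflect_real)
  then have "(?f x has_integral ?I (-x)) {-r..0}" by simp
  from has_integral_combine[OF _ _ this pos[of x]] assms
  have "(?f x has_integral ?I (-x) + ?I x) {-r..r}" by simp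
  then have "((\<lambda>\<xi>. ?f x \<xi> * complex_of_real (1 / r\<^sup>2)) has_integral
      (?I (-x) + ?I x) * complex_of_real (1 / r\<^sup>2)) {-r..r}"
    by (rule has_integral_mult_left)
  moreover have "(?I (-x) + ?I x) * complex_of_real (1 / r\<^sup>2) = complex_of_real (sinc_square (r * x / 2))"
  proof (cases "x = 0")
    case False
    have "cis (r * x) + cis (- (r * x)) = complex_of_real (2 * cos (r * x))"
      by (simp add: complex_eq_iff)
    then have "?I (-x) + ?I x = complex_of_real ((2 - 2 * cos (r * x)) / x\<^sup>2)"
      using False by (simp add: add_divide_distrib[symmetric] diff_divide_distrib[symmetric])
        (simp add: algebra_simps)
    then show ?thesis
      using False assms
      by (simp add: one_minus_cos_half sinc_square_def power_divide power_mult_distrib mult.commute)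
  qed (use assms in \<open>simp add: sinc_square_def\<close>)
  ultimately show ?thesis
    by (simp add: mult.assoc flip: of_real_mult)
qed

lemma sinc_square_in_exp_type_functions:
  assumes "1 \<le> n"
  shows "(\<lambda>x. complex_of_real (sinc_square (real n * x / 2))) \<in> exp_type_functions n"
proof -
  let ?J = "{- real n..real n}"
  define h where "h \<xi> = complex_of_real ((real n - \<bar>\<xi>\<bar>) / (real n)\<^sup>2)" for \<xi>
  \<comment> \<open>The triangle cut off outside the interval is square integrable on the whole
    line; inside, its continuity lets the Lebesgue integral be evaluated as a gauge
    integral.\<close>
  define g where "g \<xi> = indicator ?J \<xi> *\<^sub>R h \<xi>" for \<xi>
  have h: "continuous_on ?J h"
    unfolding h_def by (intro continuous_intros) (use assms in auto)
  have "set_integrable lebesgue ?J h"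
    using h by (rule absolutely_integrable_continuous_real)
  then have "g \<in> borel_measurable lebesgue"
    unfolding set_integrable_def g_def by (rule borel_measurable_integrable)
  moreover have "set_integrable lebesgue ?J (\<lambda>\<xi>. (cmod (h \<xi>))\<^sup>2)"
    by (intro absolutely_integrable_continuous_real continuous_intros h)
  then have "integrable lebesgue (\<lambda>\<xi>. (cmod (g \<xi>))\<^sup>2)"
    unfolding set_integrable_def g_def
    by (rule back_subst[where P = "integrable lebesgue"]) (auto simp: indicator_def)
  moreover have "complex_of_real (sinc_square (real n * x / 2)) = (LINT \<xi>:?J|lebesgue. cis (x * \<xi>) * g \<xi>)" for x
  proof -
    have "(LINT \<xi>:?J|lebesgue. cis (x * \<xi>) * g \<xi>) = (LINT \<xi>:?J|lebesgue. cis (x * \<xi>) * h \<xi>)"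
      by (rule set_lebesgue_integral_cong) (auto simp: g_def)
    also have "\<dots> = integral ?J (\<lambda>\<xi>. cis (x * \<xi>) * h \<xi>)"
      by (intro set_lebesgue_integral_eq_integral absolutely_integrable_continuous_real
            continuous_intros h)
    also have "\<dots> = complex_of_real (sinc_square (real n * x / 2))"
      unfolding h_def using assms by (intro integral_unique triangle_transform) auto
    finally show ?thesis by simp
  qed
  ultimately show ?thesis
    unfolding exp_type_functions_def by blast
qed

section \<open>A common positive lower bound in both cases\<close>

theorem theorem2:
  fixes T :: "real set" and A :: "nat \<Rightarrow> (real \<Rightarrow> complex) set"
    and a a' :: real and b b' :: ereal and \<psi> \<nu> :: "real \<Rightarrow> real"
  assumes "(T = {-pi..pi} \<and> A = trig_polys) \<or> (T = UNIV \<and> A = exp_type_functions)"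
    and "grand_weight a b \<psi>" and "grand_weight a' b' \<nu>"
  shows "0 < liminf (\<lambda>n. nikolskii T A real (grand_norm T a b \<psi>) (grand_norm T a' b' \<nu>) n)"
proof -
  \<comment> \<open>The constants 1/4 and 16 serve both kernels; the squared sinc gives decay
    constant 4, relaxed to 16. The index 0, where \<open>1 / real n\<close> has the default value 0,
    is left out and does not affect the limit inferior.\<close>
  have "ennreal ((1 / 4) / (pi * (1 + 16)))
      \<le> nikolskii T A real (grand_norm T a b \<psi>) (grand_norm T a' b' \<nu>) n" if n: "1 \<le> n" for n
    using assms(1)
  proof (elim disjE conjE)
    assume T: "T = {-pi..pi}" and A: "A = trig_polys"
    have "1 / real n \<le> 1" using n by simp
    then have sub: "{0..1 / real n} \<subseteq> T"
      using pi_gt3 by (auto simp: T)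
    have "continuous_on UNIV (fejer_kernel n)"
      unfolding fejer_kernel_def by (intro continuous_intros) auto
    then have "fejer_kernel n \<in> borel_measurable borel"
      by (rule borel_measurable_continuous_onI)
    then show ?thesis
      using assms(2,3) n sub fejer_kernel_ge_quarter[OF n] fejer_kernel_decay
      by (intro nikolskii_ge_of_concentrated_kernel[where f = "fejer_kernel n"])
         (auto simp: T A fejer_kernel_in_trig_polys fejer_kernel_nonneg fejer_kernel_le_1)
  next
    assume T: "T = UNIV" and A: "A = exp_type_functions"
    have quarter: "1 / 4 \<le> sinc_square (real n * x / 2)" if "0 \<le> x" "x \<le> 1 / real n" for x
    proof (rule sinc_square_ge_quarter)
      have "real n * x \<le> 1" using that n by (simp add: field_simps)
      then show "\<bar>real n * x / 2\<bar> \<le> pi / 2" using that pi_gt3 by simp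
    qed
    have decay: "sinc_square (real n * x / 2) * (real n * x)\<^sup>2 \<le> 16" for x
      using sinc_square_decay[of "real n * x / 2"] by (simp add: power_divide)
    have "(\<lambda>x. sinc_square (real n * x / 2)) \<in> borel_measurable borel"
      unfolding sinc_square_def by measurable
    then show ?thesis
      using assms(2,3) n quarter decay
      by (intro nikolskii_ge_of_concentrated_kernel[where f = "\<lambda>x. sinc_square (real n * x / 2)"])
         (auto simp: T A sinc_square_in_exp_type_functions sinc_square_nonneg sinc_square_le_1)
  qed
  then have "ennreal ((1 / 4) / (pi * (1 + 16)))
      \<le> liminf (\<lambda>n. nikolskii T A real (grand_norm T a b \<psi>) (grand_norm T a' b' \<nu>) n)"
    by (intro Liminf_bounded eventually_sequentiallyI[of 1])
  moreover have "0 < ennreal ((1 / 4) / (pi * (1 + 16)))" by simp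
  ultimately show ?thesis by (rule less_le_trans[rotated])
qed

end
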